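(* Let $L=\|K\|$, let $\tau,\sigma>0$ satisfy $\tau\sigma L^2<1$, and let $(x^n,y^n)_{n\ge0}$ be generated from $(x^0,y^0)\in\mathcal X\times\mathcal Y$, with $x^{-1}=x^0$, by $$y^{n+1}\approx_2^{\delta_{n+1}}\mathrm{prox}_{\sigma h^*}\big(y^n+\sigma K(2x^n-x^{n-1})\big),\qquad x^{n+1}\approx_2^{\varepsilon_{n+1}}\mathrm{prox}_{\tau g}\big(x^n-\tau K^*y^{n+1}\big),\qquad n\ge0,$$ where $\varepsilon_n,\delta_n\ge0$ $(n\ge1)$. Put $X^N:=\frac1N\sum_{n=1}^Nx^n$ and $Y^N:=\frac1N\sum_{n=1}^Ny^n$. If the sequences $\{\varepsilon_n\}$ and $\{\delta_n\}$ are summable, then every weak cluster point $(x^*,y^* )$ of the sequence $(X^N,Y^N)_{N\ge1}$ is a saddle point of $\mathcal L$. Moreover, if $\mathcal X$ and $\mathcal Y$ are finite dimensional, then there exists a saddle point $(x^*,y^* )\in\mathcal X\times\mathcal Y$ of $\mathcal L$ such that $x^n\to x^*$ and $y^n\to y^*$.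
   Context: $\mathcal X,\mathcal Y$ are real Hilbert spaces and $\bar{\mathbb R}=\mathbb R\cup\{+\infty\}$. $K:\mathcal X\to\mathcal Y$ is a bounded linear operator; $g:\mathcal X\to\bar{\mathbb R}$ and $h:\mathcal Y\to\bar{\mathbb R}$ are proper, convex, lower semicontinuous; $h^*$ is the convex conjugate of $h$. Put $$\mathcal L(x,y)=\langle y,Kx\rangle+g(x)-h^*(y).$$ A saddle point is a pair $(x^\star,y^\star)$ with $\mathcal L(x^\star,y)\le\mathcal L(x^\star,y^\star)\le\mathcal L(x,y^\star)$ for all $(x,y)\in\mathcal X\times\mathcal Y$; at least one is assumed to exist. Type-2 inexact proximal points. For a proper, convex, lower semicontinuous $\varphi:\mathcal H\to\bar{\mathbb R}$ on a Hilbert space $\mathcal H$, $\lambda>0$, $v\in\mathcal H$ and $\varepsilon\ge0$, let $\mathrm{prox}_{\lambda\varphi}(v)=\arg\min_{u}\{\frac1{2\lambda}\|u-v\|^2+\varphi(u)\}$ and $\partial_\varepsilon\varphi(z)=\{p:\varphi(u)\ge\varphi(z)+\langle p,u-z\rangle-\varepsilon\ \forall u\}$. Then $z\approx_2^{\varepsilon}\mathrm{prox}_{\lambda\varphi}(v)$ means $(v-z)/\lambda\in\partial_\varepsilon\varphi(z)$. *)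

theory Defs
  imports "HOL-Analysis.Analysis"
begin

text \<open>Real Hilbert spaces are types of sort \<open>{real_inner, banach}\<close>. Functions into the reals
  extended by plus infinity are \<^typ>\<open>ereal\<close>-valued functions, the value minus infinity being
  excluded by properness.\<close>

definition proper_fun :: "('a \<Rightarrow> ereal) \<Rightarrow> bool" where
  "proper_fun \<phi> \<longleftrightarrow> (\<forall>x. \<phi> x \<noteq> -\<infinity>) \<and> (\<exists>x. \<phi> x \<noteq> \<infinity>)"

definition convex_fun :: "('a::real_vector \<Rightarrow> ereal) \<Rightarrow> bool" where
  "convex_fun \<phi> \<longleftrightarrow> (\<forall>x y. \<forall>t\<in>{0<..<1}.
     \<phi> ((1 - t) *\<^sub>R x + t *\<^sub>R y) \<le> ereal (1 - t) * \<phi> x + ereal t * \<phi> y)"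

definition lsc_fun :: "('a::topological_space \<Rightarrow> ereal) \<Rightarrow> bool" where
  "lsc_fun \<phi> \<longleftrightarrow> (\<forall>x. \<phi> x \<le> Liminf (at x) \<phi>)"

definition convex_conjugate :: "('a::real_inner \<Rightarrow> ereal) \<Rightarrow> 'a \<Rightarrow> ereal" where
  "convex_conjugate h y = (SUP u. ereal (y \<bullet> u) - h u)"

text \<open>On \<^typ>\<open>ereal\<close>, the expression \<open>\<infinity> - \<infinity>\<close> evaluates to \<open>\<infinity>\<close>. It occurs below only when both
  \<open>g x = \<infinity>\<close> and \<open>convex_conjugate h y = \<infinity>\<close>. The choice does not affect the notion of saddle
  point for proper \<open>g\<close> and \<open>convex_conjugate h\<close>: the inequalities force \<open>g\<close> to be finite at the
  first and \<open>convex_conjugate h\<close> at the second component of a saddle point.\<close>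

definition Lagrangian ::
  "('a::real_inner \<Rightarrow> 'b::real_inner) \<Rightarrow> ('a \<Rightarrow> ereal) \<Rightarrow> ('b \<Rightarrow> ereal) \<Rightarrow> 'a \<Rightarrow> 'b \<Rightarrow> ereal" where
  "Lagrangian K g h x y = ereal (y \<bullet> K x) + g x - convex_conjugate h y"

definition saddle_point :: "('a \<Rightarrow> 'b \<Rightarrow> ereal) \<Rightarrow> 'a \<times> 'b \<Rightarrow> bool" where
  "saddle_point L p \<longleftrightarrow>
     (\<forall>x y. L (fst p) y \<le> L (fst p) (snd p) \<and> L (fst p) (snd p) \<le> L x (snd p))"

definition eps_subdifferential :: "real \<Rightarrow> ('a::real_inner \<Rightarrow> ereal) \<Rightarrow> 'a \<Rightarrow> 'a set" where
  "eps_subdifferential \<epsilon> \<phi> z = {p. \<forall>u. \<phi> u \<ge> \<phi> z + ereal (p \<bullet> (u - z)) - ereal \<epsilon>}"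

text \<open>\<open>prox_approx2 \<epsilon> lam \<phi> v z\<close> says that \<open>z\<close> is a type-2 approximation, with precision \<open>\<epsilon>\<close>, of
  the proximal point of \<open>lam * \<phi>\<close> at \<open>v\<close>.\<close>

definition prox_approx2 :: "real \<Rightarrow> real \<Rightarrow> ('a::real_inner \<Rightarrow> ereal) \<Rightarrow> 'a \<Rightarrow> 'a \<Rightarrow> bool" where
  "prox_approx2 \<epsilon> lam \<phi> v z \<longleftrightarrow> (v - z) /\<^sub>R lam \<in> eps_subdifferential \<epsilon> \<phi> z"

text \<open>Truncated subtraction on \<^typ>\<open>nat\<close> encodes the convention that the iterate with index \<open>-1\<close>
  equals \<open>x 0\<close>: for \<open>n = 0\<close>, \<open>x (n - 1)\<close> is \<open>x 0\<close>.\<close>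

definition inexact_primal_dual ::
  "('a::real_inner \<Rightarrow> 'b::real_inner) \<Rightarrow> ('a \<Rightarrow> ereal) \<Rightarrow> ('b \<Rightarrow> ereal) \<Rightarrow> real \<Rightarrow> real \<Rightarrow>
    (nat \<Rightarrow> real) \<Rightarrow> (nat \<Rightarrow> real) \<Rightarrow> (nat \<Rightarrow> 'a) \<Rightarrow> (nat \<Rightarrow> 'b) \<Rightarrow> bool" where
  "inexact_primal_dual K g h \<tau> \<sigma> \<epsilon> \<delta> x y \<longleftrightarrow> (\<forall>n.
     prox_approx2 (\<delta> (n + 1)) \<sigma> (convex_conjugate h)
       (y n + \<sigma> *\<^sub>R K (2 *\<^sub>R x n - x (n - 1))) (y (n + 1)) \<and>
     prox_approx2 (\<epsilon> (n + 1)) \<tau> g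
       (x n - \<tau> *\<^sub>R adjoint K (y (n + 1))) (x (n + 1)))"

definition ergodic_mean :: "(nat \<Rightarrow> 'a::real_vector) \<Rightarrow> nat \<Rightarrow> 'a" where
  "ergodic_mean x N = (1 / real N) *\<^sub>R (\<Sum>n=1..N. x n)"

definition weak_topology :: "'a::real_normed_vector topology" where
  "weak_topology = topology_generated_by {f -` S |(f :: 'a \<Rightarrow> real) S. bounded_linear f \<and> open S}"

text \<open>Cluster points in the sense of topology: every weak neighbourhood contains infinitely many
  members of the sequence. In particular the weak limit of any subsequence is one.\<close>

definition weak_cluster_point :: "(nat \<Rightarrow> 'a::real_normed_vector) \<Rightarrow> 'a \<Rightarrow> bool" where
  "weak_cluster_point z p \<longleftrightarrow>
     (\<forall>U. openin weak_topology U \<and> p \<in> U \<longrightarrow> (\<exists>\<^sub>F N in sequentially. z N \<in> U))"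

definition finite_dim :: "'a::real_vector itself \<Rightarrow> bool" where
  "finite_dim _ \<longleftrightarrow> (\<exists>B::'a set. finite B \<and> span B = UNIV)"

end

theory Submission
  imports Defs
begin

text \<open>For a primal-dual pair \<open>(a, b)\<close>, the \<open>\<epsilon>\<close>-subgradient inequalities of the two proximal steps add up to
  \<open>gap (x\<^bsub>n+1\<^esub>, y\<^bsub>n+1\<^esub>; a, b) \<le> V n - V (n+1) - (1 - s) Q n + \<epsilon>\<^bsub>n+1\<^esub> + \<delta>\<^bsub>n+1\<^esub>\<close>, where \<open>V\<close> is a
  Lyapunov function dominating the squared distance of the iterate to \<open>(a, b)\<close>, \<open>Q n\<close> is the
  weighted squared length of the step, and \<open>s = sqrt (\<tau> \<sigma>) L < 1\<close>. Summing and using convexity, the gap of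
  the ergodic means is \<open>O(1/N)\<close>, and the gap is weakly lower semicontinuous, so that it is nonpositive
  at weak cluster points. In finite dimensions, take \<open>(a, b)\<close> to be a saddle point: the iterates are
  bounded and \<open>Q n\<close> tends to 0, hence the gap tends to 0 along a convergent subsequence, whose
  limit is a saddle point. Choosing \<open>(a, b)\<close> to be this limit, \<open>V\<close> is decreasing up to
  summable errors and tends to 0 along the subsequence, hence along the whole sequence.\<close>

section \<open>Projections in Hilbert spaces\<close>

text \<open>By the parallelogram law, a minimizing sequence for the squared distance is Cauchy:
  convexity keeps midpoints in \<open>S\<close>, so they cannot come closer to \<open>p\<close> than
  the infimum. Completeness gives the nearest point \<open>q\<close>.\<close>

lemma Hilbert_projection:
  fixes S :: "'a::{real_inner, banach} set"
  assumes S: "closed S" "convex S" "S \<noteq> {}"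
  obtains q where "q \<in> S" "\<And>u. u \<in> S \<Longrightarrow> (p - q) \<bullet> (u - q) \<le> 0"
proof -
  define D where "D u = (norm (p - u))\<^sup>2" for u
  define d where "d = Inf (D ` S)"
  have bdd: "bdd_below (D ` S)"
    by (rule bdd_belowI[of _ 0]) (auto simp: D_def)
  have d_le: "d \<le> D u" if "u \<in> S" for u
    unfolding d_def using bdd that by (simp add: cINF_lower)
  have "\<exists>u\<in>S. D u < d + inverse (real (Suc n))" for n
    using cInf_lessD[of "D ` S" "d + inverse (real (Suc n))"] S(3)
    unfolding d_def by auto
  then obtain w where w: "\<And>n. w n \<in> S" "\<And>n. D (w n) < d + inverse (real (Suc n))"
    by metis
  have dist_le: "(dist (w m) (w n))\<^sup>2 \<le> 2 * inverse (real (Suc m)) + 2 * inverse (real (Suc n))" for m n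
  proof -
    have "(1/2) *\<^sub>R w m + (1/2) *\<^sub>R w n \<in> S"
      using S(2) w(1) by (intro convexD) auto
    moreover have "(dist (w m) (w n))\<^sup>2 = 2 * D (w m) + 2 * D (w n) - 4 * D ((1/2) *\<^sub>R w m + (1/2) *\<^sub>R w n)"
      unfolding D_def dist_norm power2_norm_eq_inner
      by (simp add: inner_simps inner_commute algebra_simps)
    ultimately show ?thesis
      using d_le[of "(1/2) *\<^sub>R w m + (1/2) *\<^sub>R w n"] w(2)[of m] w(2)[of n] by linarith
  qed
  have "Cauchy w"
  proof (rule metric_CauchyI)
    fix e :: real assume "e > 0"
    \<comment> \<open>Each of the two indices contributes at most twice this threshold to
      \<open>dist_le\<close>, which adds up to \<open>e\<^sup>2\<close>.\<close>
    then have "e\<^sup>2 / 4 > 0" by simp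
    then obtain M where M: "inverse (real (Suc M)) < e\<^sup>2 / 4"
      using reals_Archimedean by blast
    have "dist (w m) (w n) < e" if "m \<ge> M" "n \<ge> M" for m n
    proof -
      have "inverse (real (Suc m)) \<le> inverse (real (Suc M))" "inverse (real (Suc n)) \<le> inverse (real (Suc M))"
        using that by (auto intro!: le_imp_inverse_le)
      with dist_le[of m n] M have "(dist (w m) (w n))\<^sup>2 < e\<^sup>2" by linarith
      then show ?thesis using \<open>e > 0\<close> by (simp add: power2_less_imp_less)
    qed
    then show "\<exists>M. \<forall>m\<ge>M. \<forall>n\<ge>M. dist (w m) (w n) < e" by blast
  qed
  then obtain q where q: "w \<longlonglongrightarrow> q"
    using Cauchy_convergent convergent_def by blast
  have "q \<in> S"
    using closed_sequentially[OF S(1) w(1) q] .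
  have "(\<lambda>n. D (w n)) \<longlonglongrightarrow> D q"
    unfolding D_def by (intro tendsto_intros q)
  moreover have "(\<lambda>n. d + inverse (real (Suc n))) \<longlonglongrightarrow> d + 0"
    by (intro tendsto_add tendsto_const LIMSEQ_inverse_real_of_nat)
  ultimately have "D q \<le> d"
    using LIMSEQ_le[of "\<lambda>n. D (w n)" "D q" "\<lambda>n. d + inverse (real (Suc n))" "d + 0"]
    by (simp add: less_imp_le[OF w(2)] del: of_nat_Suc)
  have "dist p q \<le> dist p u" if "u \<in> S" for u
  proof -
    have "(norm (p - q))\<^sup>2 \<le> (norm (p - u))\<^sup>2"
      using order_trans[OF \<open>D q \<le> d\<close> d_le[OF that]] by (simp only: D_def)
    then show ?thesis unfolding dist_norm by (rule power2_le_imp_le) simp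
  qed
  then show thesis
    using that any_closest_point_dot[OF S(2,1) \<open>q \<in> S\<close>] \<open>q \<in> S\<close> by blast
qed

text \<open>The residual \<open>w\<close> of projecting a point \<open>c\<close> outside the kernel
  onto the kernel is orthogonal to the kernel, and every \<open>u\<close> differs from a vector of
  the kernel by a multiple of \<open>w\<close>.\<close>

lemma Riesz_representation:
  fixes f :: "'a::{real_inner, banach} \<Rightarrow> real"
  assumes "bounded_linear f"
  obtains v where "\<And>u. f u = u \<bullet> v"
proof (cases "\<forall>u. f u = 0")
  case True
  then show thesis using that[of 0] by simp
next
  case False
  interpret bounded_linear f by fact
  obtain c where c: "f c \<noteq> 0" using False by blast
  define S where "S = f -` {0}"
  have "closed S"
    unfolding S_def by (intro closed_vimage linear_continuous_on bounded_linear_axioms) auto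
  moreover have "convex S"
    unfolding S_def by (rule convex_linear_vimage[OF linear_axioms]) simp
  moreover have "S \<noteq> {}" unfolding S_def using zero by blast
  ultimately obtain q where q: "q \<in> S" "\<And>u. u \<in> S \<Longrightarrow> (c - q) \<bullet> (u - q) \<le> 0"
    using Hilbert_projection[of S c] by blast
  have fq: "f q = 0" using q(1) by (simp add: S_def)
  \<comment> \<open>Both \<open>q + u\<close> and \<open>q - u\<close> lie in the kernel, so the
    variational inequality holds with both signs.\<close>
  have orth: "(c - q) \<bullet> u = 0" if "f u = 0" for u
    using q(2)[of "q + u"] q(2)[of "q - u"] that fq by (simp add: S_def add diff)
  define w where "w = c - q"
  have fw: "f w = f c" and w0: "w \<noteq> 0" using c fq by (auto simp: w_def diff)
  have "f u = u \<bullet> ((f w / (w \<bullet> w)) *\<^sub>R w)" for u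
  proof -
    have "w \<bullet> (u - (f u / f w) *\<^sub>R w) = 0"
      unfolding w_def by (rule orth) (use c fw in \<open>simp add: w_def diff scale\<close>)
    then show ?thesis using w0 c fw
      by (simp add: inner_simps inner_commute field_simps)
  qed
  then show thesis by (rule that)
qed

text \<open>\<open>adjoint\<close> is defined by choice, so its identity requires that some adjoint
  map exists; Riesz representation provides one.\<close>

lemma adjoint_inner:
  fixes K :: "'a::{real_inner, banach} \<Rightarrow> 'b::real_inner"
  assumes K: "bounded_linear K"
  shows "adjoint K b \<bullet> a = b \<bullet> K a"
proof -
  have "\<exists>v. \<forall>u. K u \<bullet> c = u \<bullet> v" for c
  proof -
    have "bounded_linear (\<lambda>u. K u \<bullet> c)"
      using bounded_linear_compose[OF bounded_linear_inner_left K] .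
    then show ?thesis by (metis Riesz_representation)
  qed
  then have "\<exists>f'. \<forall>u c. K u \<bullet> c = u \<bullet> f' c" by metis
  then have "\<forall>u c. K u \<bullet> c = u \<bullet> adjoint K c"
    unfolding adjoint_def by (rule someI_ex)
  then show ?thesis by (simp add: inner_commute)
qed

section \<open>Convex extended-real-valued functions\<close>

lemma lsc_fun_closed_sublevel:
  fixes \<phi> :: "'a::topological_space \<Rightarrow> ereal"
  assumes "lsc_fun \<phi>"
  shows "closed {u. \<phi> u \<le> c}"
proof -
  have "eventually (\<lambda>v. c < \<phi> v) (nhds u)" if "c < \<phi> u" for u
  proof -
    have "c < Liminf (at u) \<phi>"
      using assms that unfolding lsc_fun_def by (meson less_le_trans)
    then have "eventually (\<lambda>v. c < \<phi> v) (at u)" by (rule less_LiminfD)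
    \<comment> \<open>The filter \<open>at u\<close> leaves out \<open>u\<close> itself, where the
      inequality is the assumption.\<close>
    then show ?thesis unfolding eventually_at_filter
      by (rule eventually_mono) (use that in auto)
  qed
  then have "open {u. c < \<phi> u}"
    by (subst open_subopen) (force simp: eventually_nhds)
  moreover have "{u. \<phi> u \<le> c} = - {u. c < \<phi> u}" by auto
  ultimately show ?thesis by (simp add: closed_def)
qed

text \<open>Adds the endpoints \<open>t = 0\<close> and \<open>t = 1\<close> to the definition and
  trades extended values for real upper bounds.\<close>

lemma convex_fun_ereal_le:
  assumes "convex_fun \<phi>" "\<phi> u \<le> ereal a" "\<phi> v \<le> ereal b" "0 \<le> t" "t \<le> 1"
  shows "\<phi> ((1 - t) *\<^sub>R u + t *\<^sub>R v) \<le> ereal ((1 - t) * a + t * b)"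
proof -
  consider "t = 0" | "t = 1" | "t \<in> {0<..<1}" using assms(4,5) by fastforce
  then show ?thesis
  proof cases
    case 3
    have "\<phi> ((1 - t) *\<^sub>R u + t *\<^sub>R v) \<le> ereal (1 - t) * \<phi> u + ereal t * \<phi> v"
      using assms(1) 3 unfolding convex_fun_def by blast
    also have "\<dots> \<le> ereal (1 - t) * ereal a + ereal t * ereal b"
      using 3 assms(2,3) by (intro add_mono ereal_mult_left_mono) auto
    finally show ?thesis by simp
  qed (use assms in auto)
qed

lemma convex_fun_sublevel:
  assumes "convex_fun \<phi>"
  shows "convex {u. \<phi> u \<le> ereal c}"
proof (rule convexI)
  fix u v and s t :: real
  assume "u \<in> {u. \<phi> u \<le> ereal c}" "v \<in> {u. \<phi> u \<le> ereal c}" "0 \<le> s" "0 \<le> t" "s + t = 1"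
  moreover from this have "s = 1 - t" by simp
  ultimately show "s *\<^sub>R u + t *\<^sub>R v \<in> {u. \<phi> u \<le> ereal c}"
    using convex_fun_ereal_le[OF assms, of u c v c t] by (simp add: left_diff_distrib)
qed

text \<open>Weak lower semicontinuity in the form of a separating half-space: its normal is the
  residual of projecting \<open>p\<close> onto the closed convex sublevel set.\<close>

lemma convex_fun_weak_lsc:
  fixes \<phi> :: "'a::{real_inner, banach} \<Rightarrow> ereal"
  assumes conv: "convex_fun \<phi>" and closed: "closed {u. \<phi> u \<le> ereal c}" and "ereal c < \<phi> p"
  obtains d \<alpha> where "\<alpha> < p \<bullet> d" "\<And>u. \<alpha> < u \<bullet> d \<Longrightarrow> ereal c < \<phi> u"
proof (cases "{u. \<phi> u \<le> ereal c} = {}")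
  case True
  then have "ereal c < \<phi> u" for u by (simp add: not_le[symmetric])
  then show thesis using that[of "-1" 0] by simp
next
  case False
  obtain q where q: "q \<in> {u. \<phi> u \<le> ereal c}"
    "\<And>u. u \<in> {u. \<phi> u \<le> ereal c} \<Longrightarrow> (p - q) \<bullet> (u - q) \<le> 0"
    using Hilbert_projection[OF closed convex_fun_sublevel[OF conv] False] by blast
  have "p \<noteq> q" using q(1) \<open>ereal c < \<phi> p\<close> by auto
  then have "0 < (p - q) \<bullet> (p - q)" by simp
  then have "q \<bullet> (p - q) < p \<bullet> (p - q)" by (simp add: inner_simps)
  moreover have "ereal c < \<phi> u" if "q \<bullet> (p - q) < u \<bullet> (p - q)" for u
    using q(2)[of u] that by (force simp: inner_simps inner_commute)
  ultimately show thesis using that by blast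
qed

text \<open>This is the domain of a proper function; points of value \<open>-\<infinity>\<close> are not excluded here.\<close>

definition finite_on :: "('a \<Rightarrow> ereal) \<Rightarrow> 'a set" where
  "finite_on \<phi> = {u. \<phi> u \<noteq> \<infinity>}"

lemma proper_real_of_ereal:
  assumes "proper_fun \<phi>" "u \<in> finite_on \<phi>"
  shows "\<phi> u = ereal (real_of_ereal (\<phi> u))"
  using assms unfolding proper_fun_def finite_on_def by (cases "\<phi> u") auto

lemma convex_on_real_of_ereal:
  assumes \<phi>: "proper_fun \<phi>" "convex_fun \<phi>"
  shows "convex_on (finite_on \<phi>) (\<lambda>u. real_of_ereal (\<phi> u))"
proof -
  have *: "(1 - t) *\<^sub>R u + t *\<^sub>R v \<in> finite_on \<phi> \<and>
      real_of_ereal (\<phi> ((1 - t) *\<^sub>R u + t *\<^sub>R v))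
        \<le> (1 - t) * real_of_ereal (\<phi> u) + t * real_of_ereal (\<phi> v)"
    if "u \<in> finite_on \<phi>" "v \<in> finite_on \<phi>" "0 \<le> t" "t \<le> 1" for u v t
  proof -
    have le: "\<phi> ((1 - t) *\<^sub>R u + t *\<^sub>R v)
        \<le> ereal ((1 - t) * real_of_ereal (\<phi> u) + t * real_of_ereal (\<phi> v))"
      using that proper_real_of_ereal[OF \<phi>(1)] by (intro convex_fun_ereal_le[OF \<phi>(2)]) auto
    then have fin: "(1 - t) *\<^sub>R u + t *\<^sub>R v \<in> finite_on \<phi>" by (auto simp: finite_on_def)
    show ?thesis using fin le proper_real_of_ereal[OF \<phi>(1) fin] by (metis ereal_less_eq(3))
  qed
  then have "convex (finite_on \<phi>)"
    unfolding convex_alt by blast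
  then show ?thesis using * by (intro convex_onI) auto
qed

text \<open>Jensen's inequality with the weights \<open>1 / real N\<close>.\<close>

lemma convex_fun_ergodic_mean:
  assumes \<phi>: "proper_fun \<phi>" "convex_fun \<phi>" and N: "N \<ge> 1"
    and fin: "\<And>n. n \<ge> 1 \<Longrightarrow> x n \<in> finite_on \<phi>"
  shows "\<phi> (ergodic_mean x N) \<le> ereal ((\<Sum>n=1..N. real_of_ereal (\<phi> (x n))) / real N)"
proof -
  have C: "convex_on (finite_on \<phi>) (\<lambda>u. real_of_ereal (\<phi> u))"
    by (rule convex_on_real_of_ereal[OF \<phi>])
  have mean: "ergodic_mean x N = (\<Sum>n=1..N. (1 / real N) *\<^sub>R x n)"
    unfolding ergodic_mean_def by (rule scaleR_right.sum)
  have "real_of_ereal (\<phi> (ergodic_mean x N)) \<le> (\<Sum>n=1..N. (1 / real N) * real_of_ereal (\<phi> (x n)))"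
    unfolding mean by (rule convex_on_sum[OF _ _ C]) (use N fin in auto)
  moreover have "ergodic_mean x N \<in> finite_on \<phi>"
    unfolding mean by (rule convex_sum) (use N fin convex_on_imp_convex[OF C] in auto)
  ultimately show ?thesis
    by (subst proper_real_of_ereal[OF \<phi>(1)]) (auto simp: sum_divide_distrib)
qed

section \<open>Conjugates\<close>

lemma closed_epigraph:
  fixes \<phi> :: "'a::topological_space \<Rightarrow> ereal"
  assumes "\<And>c. closed {u. \<phi> u \<le> ereal c}"
  shows "closed {(u, t). \<phi> u \<le> ereal t}"
proof -
  \<comment> \<open>A pair lies outside the epigraph exactly if some real \<open>r\<close> satisfies
    \<open>t < r\<close> and \<open>r < \<phi> u\<close>.\<close>
  have "{(u, t). \<phi> u \<le> ereal t} = (\<Inter>r. ({u. \<phi> u \<le> ereal r} \<times> UNIV) \<union> (UNIV \<times> {r..}))"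
    (is "?E = ?I")
  proof (intro equalityI subsetI)
    fix z assume "z \<in> ?E" then show "z \<in> ?I"
      by (auto simp: not_le intro: order_trans)
  next
    fix z assume z: "z \<in> ?I"
    obtain u t where zt: "z = (u, t)" by (cases z)
    have le: "\<phi> u \<le> ereal r" if "t < r" for r using z that by (auto simp: zt)
    have "\<phi> u \<le> ereal t"
    proof (rule ccontr)
      assume "\<not> \<phi> u \<le> ereal t"
      then obtain r where "ereal t < ereal r" "ereal r < \<phi> u"
        using ereal_dense2 not_le by metis
      then show False using le[of r] by simp
    qed
    then show "z \<in> ?E" by (simp add: zt)
  qed
  moreover have "closed ?I"
    by (intro closed_INT ballI closed_Un closed_Times assms) auto
  ultimately show ?thesis by simp
qed

lemma convex_epigraph:
  assumes "convex_fun \<phi>"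
  shows "convex {(u, t). \<phi> u \<le> ereal t}"
  unfolding convex_alt using convex_fun_ereal_le[OF assms] by auto

text \<open>The point \<open>(u\<^sub>0, h u\<^sub>0 - 1)\<close> lies strictly below the epigraph of \<open>h\<close>, and since \<open>u\<^sub>0\<close> is in the
  domain of \<open>h\<close>, the hyperplane through its projection on the epigraph is not vertical. This
  hyperplane is the graph of an affine minorant of \<open>h\<close>.\<close>

lemma proper_convex_conjugate:
  fixes h :: "'a::{real_inner, banach} \<Rightarrow> ereal"
  assumes h: "proper_fun h" "convex_fun h" and closed: "\<And>c. closed {u. h u \<le> ereal c}"
  shows "proper_fun (convex_conjugate h)"
proof -
  obtain u0 where u0: "h u0 \<noteq> \<infinity>" using h(1) unfolding proper_fun_def by blast
  define r0 where "r0 = real_of_ereal (h u0)"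
  have hu0: "h u0 = ereal r0"
    unfolding r0_def using proper_real_of_ereal[OF h(1)] u0 by (simp add: finite_on_def)
  define E where "E = {(u, t). h u \<le> ereal t}"
  have "(u0, r0) \<in> E" using hu0 by (simp add: E_def)
  then have "E \<noteq> {}" by blast
  then obtain q where q: "q \<in> E" "\<And>z. z \<in> E \<Longrightarrow> ((u0, r0 - 1) - q) \<bullet> (z - q) \<le> 0"
    using Hilbert_projection[OF closed_epigraph[OF closed] convex_epigraph[OF h(2)]]
    unfolding E_def by blast
  obtain u1 t1 where q1: "q = (u1, t1)" by (cases q)
  have ineq: "(u0 - u1) \<bullet> (u - u1) + (r0 - 1 - t1) * (t - t1) \<le> 0" if "h u \<le> ereal t" for u t
    using q(2)[of "(u, t)"] that by (simp add: q1 E_def)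
  \<comment> \<open>Raising the height of \<open>q\<close> by 1 stays in the epigraph, so the normal
    cannot point upwards.\<close>
  have "r0 - 1 \<le> t1"
    using ineq[of u1 "t1 + 1"] q(1) by (simp add: q1 E_def order_trans[of _ "ereal t1"])
  \<comment> \<open>Equality would make the hyperplane vertical; testing with
    \<open>(u0, r0)\<close> then puts \<open>q\<close> at \<open>(u0, r0 - 1)\<close>, below the
    epigraph.\<close>
  moreover have "r0 - 1 \<noteq> t1"
  proof
    assume eq: "r0 - 1 = t1"
    then have "(u0 - u1) \<bullet> (u0 - u1) \<le> 0" using ineq[of u0 r0] hu0 by simp
    then have "u0 = u1" by (metis inner_gt_zero_iff not_le right_minus_eq)
    then show False using q(1) hu0 eq by (simp add: q1 E_def)
  qed
  ultimately have s: "t1 - (r0 - 1) > 0" by simp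
  \<comment> \<open>The slope of the minorant: the normal is rescaled so that its last component is
    -1.\<close>
  define y where "y = (u0 - u1) /\<^sub>R (t1 - (r0 - 1))"
  have "ereal (y \<bullet> u) - h u \<le> ereal (y \<bullet> u1 - t1)" for u
  proof (cases "h u")
    case (real t)
    have "(u0 - u1) \<bullet> (u - u1) \<le> (t1 - (r0 - 1)) * (t - t1)"
      using ineq[of u t] real by (simp add: algebra_simps)
    then have "y \<bullet> (u - u1) \<le> t - t1"
      using s by (simp add: y_def inverse_eq_divide pos_divide_le_eq mult.commute)
    then show ?thesis using real by (simp add: inner_simps)
  qed (use h(1) in \<open>auto simp: proper_fun_def\<close>)
  then have "convex_conjugate h y \<le> ereal (y \<bullet> u1 - t1)"
    unfolding convex_conjugate_def by (intro SUP_least)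
  then have "convex_conjugate h y \<noteq> \<infinity>" by auto
  moreover have "convex_conjugate h v \<noteq> -\<infinity>" for v
  proof -
    have "ereal (v \<bullet> u0) - h u0 \<le> convex_conjugate h v"
      unfolding convex_conjugate_def by (rule SUP_upper) simp
    then show ?thesis using hu0 by auto
  qed
  ultimately show ?thesis unfolding proper_fun_def by blast
qed

text \<open>A supremum of functions of \<open>y\<close>, each affine or, where \<open>h u\<close> is
  infinite, constantly \<open>-\<infinity>\<close>.\<close>

lemma convex_convex_conjugate:
  assumes "proper_fun h"
  shows "convex_fun (convex_conjugate h)"
  unfolding convex_fun_def
proof (intro allI ballI)
  fix y z :: 'a and t :: real assume t: "t \<in> {0<..<1}"
  show "convex_conjugate h ((1 - t) *\<^sub>R y + t *\<^sub>R z)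
      \<le> ereal (1 - t) * convex_conjugate h y + ereal t * convex_conjugate h z"
    unfolding convex_conjugate_def[of h "(1 - t) *\<^sub>R y + t *\<^sub>R z"]
  proof (rule SUP_least)
    fix u
    have "ereal (((1 - t) *\<^sub>R y + t *\<^sub>R z) \<bullet> u) - h u
        = ereal (1 - t) * (ereal (y \<bullet> u) - h u) + ereal t * (ereal (z \<bullet> u) - h u)"
      using assms t by (cases "h u") (auto simp: proper_fun_def inner_simps algebra_simps)
    also have "\<dots> \<le> ereal (1 - t) * convex_conjugate h y + ereal t * convex_conjugate h z"
      using t unfolding convex_conjugate_def
      by (intro add_mono ereal_mult_left_mono SUP_upper) auto
    finally show "ereal (((1 - t) *\<^sub>R y + t *\<^sub>R z) \<bullet> u) - h u
        \<le> ereal (1 - t) * convex_conjugate h y + ereal t * convex_conjugate h z" .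
  qed
qed

text \<open>An intersection of closed half-spaces, and of the whole space where \<open>h u\<close>
  is infinite. This is the form of lower semicontinuity that the separation argument takes.\<close>

lemma closed_convex_conjugate_sublevel:
  assumes "proper_fun h"
  shows "closed {y. convex_conjugate h y \<le> ereal c}"
proof -
  have "closed {y. ereal (y \<bullet> u) - h u \<le> ereal c}" for u
  proof (cases "h u")
    case (real r)
    have "closed {y. y \<bullet> u - r \<le> c}"
      by (intro closed_Collect_le continuous_intros)
    then show ?thesis using real by simp
  qed (use assms in \<open>auto simp: proper_fun_def\<close>)
  moreover have "{y. convex_conjugate h y \<le> ereal c} = (\<Inter>u. {y. ereal (y \<bullet> u) - h u \<le> ereal c})"
    unfolding convex_conjugate_def SUP_le_iff by blast
  ultimately show ?thesis by (simp add: closed_INT)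
qed

section \<open>Weak topology and finite dimension\<close>

lemma openin_weak_topology_vimage:
  fixes f :: "'a::real_normed_vector \<Rightarrow> real"
  shows "bounded_linear f \<Longrightarrow> open S \<Longrightarrow> openin weak_topology (f -` S)"
  unfolding weak_topology_def
  by (rule topology_generated_by_Basis, unfold mem_Collect_eq, intro exI[of _ f] exI[of _ S] conjI refl)

lemma openin_weak_topology_imp_open:
  fixes U :: "'a::real_normed_vector set"
  assumes "openin weak_topology U"
  shows "open U"
proof -
  have "generate_topology_on {f -` S |(f :: 'a \<Rightarrow> real) S. bounded_linear f \<and> open S} U"
    using assms unfolding weak_topology_def openin_topology_generated_by_iff .
  then show ?thesis
  proof induction
    case (Basis s)
    then show ?case by (auto intro!: open_vimage linear_continuous_on)
  qed auto
qed

text \<open>Allows one saddle point criterion to serve both the ergodic means and norm-convergent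
  subsequences.\<close>

lemma tendsto_imp_weak_cluster_point:
  assumes "z \<longlonglongrightarrow> p"
  shows "weak_cluster_point z p"
  unfolding weak_cluster_point_def
proof (intro allI impI, elim conjE)
  fix U assume "openin weak_topology U" "p \<in> U"
  then have "\<forall>\<^sub>F N in sequentially. z N \<in> U"
    using assms openin_weak_topology_imp_open by (auto simp: tendsto_def)
  then show "\<exists>\<^sub>F N in sequentially. z N \<in> U"
    by (rule eventually_frequently[rotated]) simp
qed

text \<open>Coordinates are treated one at a time; a further subsequence keeps the limits already
  obtained.\<close>

lemma bounded_coordinates_convergent_subsequence:
  fixes f :: "nat \<Rightarrow> 'i \<Rightarrow> real"
  assumes "finite I" "\<And>i. i \<in> I \<Longrightarrow> Bseq (\<lambda>n. f n i)"
  shows "\<exists>r l. strict_mono (r :: nat \<Rightarrow> nat) \<and> (\<forall>i\<in>I. (\<lambda>n. f (r n) i) \<longlonglongrightarrow> l i)"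
  using assms
proof (induction I rule: finite_induct)
  case empty
  then show ?case using strict_mono_id by blast
next
  case (insert j I)
  then obtain r l where r: "strict_mono (r :: nat \<Rightarrow> nat)" "\<forall>i\<in>I. (\<lambda>n. f (r n) i) \<longlonglongrightarrow> l i"
    by auto
  have "bounded (range (\<lambda>n. f (r n) j))"
    using insert.prems[of j] unfolding Bseq_eq_bounded
    by (auto intro: bounded_subset)
  then obtain m r' where r': "strict_mono (r' :: nat \<Rightarrow> nat)" "((\<lambda>n. f (r n) j) \<circ> r') \<longlonglongrightarrow> m"
    using bounded_imp_convergent_subsequence by blast
  have "(\<lambda>n. f (r (r' n)) i) \<longlonglongrightarrow> (l(j := m)) i" if "i \<in> insert j I" for i
  proof (cases "i = j")
    case True
    then show ?thesis using r'(2) by (simp add: o_def)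
  next
    case False
    then have "(\<lambda>n. f (r n) i) \<longlonglongrightarrow> l i" using that r(2) by simp
    then show ?thesis
      using LIMSEQ_subseq_LIMSEQ[OF _ r'(1), of "\<lambda>n. f (r n) i" "l i"] False by (simp add: o_def)
  qed
  moreover have "strict_mono (\<lambda>n. r (r' n))"
    using strict_mono_o[OF r(1) r'(1)] by (simp add: o_def)
  ultimately show ?case by blast
qed

text \<open>Bolzano-Weierstrass, applied to the coordinates with respect to a finite orthogonal
  spanning set.\<close>

lemma finite_dim_convergent_subsequence:
  fixes z :: "nat \<Rightarrow> 'a::real_inner"
  assumes dim: "finite_dim TYPE('a)" and z: "Bseq z"
  obtains r l where "strict_mono (r :: nat \<Rightarrow> nat)" "(\<lambda>n. z (r n)) \<longlonglongrightarrow> l"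
proof -
  obtain B :: "'a set" where B: "finite B" "span B = UNIV"
    using dim unfolding finite_dim_def by blast
  obtain C :: "'a set" where C: "finite C" "span C = UNIV" "pairwise orthogonal C"
    using basis_orthogonal[OF B(1)] B(2) by auto
  \<comment> \<open>The set \<open>C\<close> may contain 0; that summand vanishes whatever its
    coefficient.\<close>
  have expand: "v = (\<Sum>c\<in>C. (v \<bullet> c / (c \<bullet> c)) *\<^sub>R c)" for v
  proof -
    have "v \<in> span C" using C(2) by simp
    then obtain k where k: "v = (\<Sum>c\<in>C. k c *\<^sub>R c)"
      using span_finite[OF C(1)] by auto
    have "(v \<bullet> c / (c \<bullet> c)) *\<^sub>R c = k c *\<^sub>R c" if "c \<in> C" for c
    proof -
      have "v \<bullet> c = (\<Sum>d\<in>C. k d * (d \<bullet> c))" unfolding k by (simp add: inner_sum_left)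
      also have "\<dots> = (\<Sum>d\<in>C. if d = c then k c * (c \<bullet> c) else 0)"
        using C(3) that by (intro sum.cong) (auto simp: pairwise_def orthogonal_def)
      also have "\<dots> = k c * (c \<bullet> c)" using C(1) that by simp
      finally show ?thesis by (cases "c = 0") auto
    qed
    then have "(\<Sum>c\<in>C. (v \<bullet> c / (c \<bullet> c)) *\<^sub>R c) = (\<Sum>c\<in>C. k c *\<^sub>R c)"
      by (rule sum.cong[OF refl])
    then show ?thesis using k by simp
  qed
  have "Bseq (\<lambda>n. z n \<bullet> c)" for c
  proof -
    obtain M where "\<And>n. norm (z n) \<le> M" using z by (auto simp: Bseq_def)
    then have "norm (z n \<bullet> c) \<le> M * norm c" for n
      using Cauchy_Schwarz_ineq2[of "z n" c] mult_right_mono[of "norm (z n)" M "norm c"]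
      by (metis norm_ge_zero order_trans real_norm_def)
    then show ?thesis by (rule BseqI')
  qed
  then obtain r l where r: "strict_mono (r :: nat \<Rightarrow> nat)" "\<forall>c\<in>C. (\<lambda>n. z (r n) \<bullet> c) \<longlonglongrightarrow> l c"
    using bounded_coordinates_convergent_subsequence[OF C(1), of "\<lambda>n c. z n \<bullet> c"] by auto
  have "(\<lambda>n. \<Sum>c\<in>C. (z (r n) \<bullet> c / (c \<bullet> c)) *\<^sub>R c) \<longlonglongrightarrow> (\<Sum>c\<in>C. (l c / (c \<bullet> c)) *\<^sub>R c)"
    using r(2) by (intro tendsto_sum tendsto_scaleR tendsto_const, simp add: divide_inverse tendsto_mult_right)
  then show thesis using that r(1) by (simp add: expand[symmetric])
qed

section \<open>Descent along the iteration\<close>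

text \<open>Subtracting the partial sums of \<open>e\<close> makes the sequence decreasing and
  bounded below. Hence \<open>a\<close> converges, and the subsequence identifies the limit.\<close>

lemma quasi_Fejer_tendsto_0:
  fixes a e :: "nat \<Rightarrow> real"
  assumes a: "\<And>n. 0 \<le> a n" "\<And>n. a (Suc n) \<le> a n + e n"
    and e: "\<And>n. 0 \<le> e n" "summable e"
    and r: "strict_mono r" "(\<lambda>k. a (r k)) \<longlonglongrightarrow> 0"
  shows "a \<longlonglongrightarrow> 0"
proof -
  define c where "c n = a n - (\<Sum>k<n. e k)" for n
  have "decseq c"
    by (rule decseq_SucI) (use a(2) in \<open>simp add: c_def algebra_simps\<close>)
  moreover have "- suminf e \<le> c n" for n
    using a(1)[of n] sum_le_suminf[OF e(2), of "{..<n}"] e(1) by (simp add: c_def)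
  ultimately obtain l where "c \<longlonglongrightarrow> l"
    using decseq_convergent by metis
  then have "(\<lambda>n. c n + (\<Sum>k<n. e k)) \<longlonglongrightarrow> l + suminf e"
    using summable_LIMSEQ[OF e(2)] by (intro tendsto_add)
  then have lim: "a \<longlonglongrightarrow> l + suminf e" by (simp add: c_def)
  then have "(\<lambda>k. a (r k)) \<longlonglongrightarrow> l + suminf e"
    using LIMSEQ_subseq_LIMSEQ[OF lim r(1)] by (simp add: o_def)
  then have "l + suminf e = 0" using LIMSEQ_unique r(2) by blast
  then show ?thesis using lim by simp
qed

lemma inner_diff_three_points:
  fixes a p q :: "'a::real_inner"
  shows "(p - q) \<bullet> (a - q) = ((norm (a - q))\<^sup>2 + (norm (p - q))\<^sup>2 - (norm (a - p))\<^sup>2) / 2"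
  by (simp add: power2_norm_eq_inner inner_simps inner_commute)

lemma convex_fun_weak_lsc_real:
  fixes \<phi> :: "'a::{real_inner, banach} \<Rightarrow> ereal"
  assumes \<phi>: "proper_fun \<phi>" "convex_fun \<phi>" "closed {u. \<phi> u \<le> ereal c}" "ereal c < \<phi> p"
  obtains d \<alpha> where "\<alpha> < p \<bullet> d"
    "\<And>u. u \<in> finite_on \<phi> \<Longrightarrow> \<alpha> < u \<bullet> d \<Longrightarrow> c < real_of_ereal (\<phi> u)"
proof -
  obtain d \<alpha> where d: "\<alpha> < p \<bullet> d" "\<And>u. \<alpha> < u \<bullet> d \<Longrightarrow> ereal c < \<phi> u"
    using convex_fun_weak_lsc[OF \<phi>(2-4)] by blast
  show thesis
  proof (rule that[OF d(1)])
    fix u assume "u \<in> finite_on \<phi>" "\<alpha> < u \<bullet> d"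
    then show "c < real_of_ereal (\<phi> u)"
      using d(2) proper_real_of_ereal[OF \<phi>(1)] by (metis ereal_less(1) less_ereal.simps(1))
  qed
qed

section \<open>The inexact iteration, its gap and its Lyapunov function\<close>

locale primal_dual =
  fixes K :: "'a::{real_inner, banach} \<Rightarrow> 'b::{real_inner, banach}"
    and g :: "'a \<Rightarrow> ereal" and h :: "'b \<Rightarrow> ereal"
    and \<tau> \<sigma> :: real and \<epsilon> \<delta> :: "nat \<Rightarrow> real"
    and x :: "nat \<Rightarrow> 'a" and y :: "nat \<Rightarrow> 'b"
  assumes K: "bounded_linear K"
    and g: "proper_fun g" "convex_fun g" "lsc_fun g"
    and h: "proper_fun h" "convex_fun h" "lsc_fun h"
    and steps: "\<tau> > 0" "\<sigma> > 0" "\<tau> * \<sigma> * (onorm K)\<^sup>2 < 1"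
    and errors: "\<And>n. n \<ge> 1 \<Longrightarrow> \<epsilon> n \<ge> 0" "\<And>n. n \<ge> 1 \<Longrightarrow> \<delta> n \<ge> 0"
    and iterates: "inexact_primal_dual K g h \<tau> \<sigma> \<epsilon> \<delta> x y"
    and summable: "summable (\<lambda>n. \<epsilon> (n + 1))" "summable (\<lambda>n. \<delta> (n + 1))"
begin

abbreviation f :: "'b \<Rightarrow> ereal" where "f \<equiv> convex_conjugate h"
abbreviation G :: "'a \<Rightarrow> real" where "G u \<equiv> real_of_ereal (g u)"
abbreviation F :: "'b \<Rightarrow> real" where "F v \<equiv> real_of_ereal (f v)"

definition s :: real where "s = sqrt (\<tau> * \<sigma>) * onorm K"

text \<open>The difference of the Lagrangian at \<open>(u, b)\<close> and at \<open>(a, v)\<close>.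
  It has this meaning only on the domains, since \<open>real_of_ereal\<close> maps infinite values
  to 0.\<close>

definition gap :: "'a \<Rightarrow> 'b \<Rightarrow> 'a \<Rightarrow> 'b \<Rightarrow> real" where
  "gap u v a b = (b \<bullet> K u + G u - F b) - (v \<bullet> K a + G a - F v)"

definition energy :: "'a \<Rightarrow> 'b \<Rightarrow> real" where
  "energy u v = (norm u)\<^sup>2 / (2 * \<tau>) + (norm v)\<^sup>2 / (2 * \<sigma>)"

text \<open>Truncated subtraction makes \<open>dx 0\<close> zero, which matches the convention for
  the iterate at index -1.\<close>

definition dx :: "nat \<Rightarrow> 'a" where "dx n = x n - x (n - 1)"
definition dy :: "nat \<Rightarrow> 'b" where "dy n = y n - y (n - 1)"

definition err :: "nat \<Rightarrow> real" where "err n = \<epsilon> n + \<delta> n"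

text \<open>The inner product cancels the extrapolation term of the dual step by telescoping; the last
  summand pays for the mixed term of \<open>dx n\<close> and \<open>dy (n + 1)\<close> that is left over.\<close>

definition V :: "'a \<Rightarrow> 'b \<Rightarrow> nat \<Rightarrow> real" where
  "V a b n = energy (a - x n) (b - y n) - K (dx n) \<bullet> (b - y n) + s * ((norm (dx n))\<^sup>2 / (2 * \<tau>))"

lemma f_proper: "proper_fun f"
  by (rule proper_convex_conjugate[OF h(1,2) lsc_fun_closed_sublevel[OF h(3)]])

lemma f_convex: "convex_fun f"
  by (rule convex_convex_conjugate[OF h(1)])

lemma linear_K: "linear K"
  using K by (rule bounded_linear.linear)

lemmas K_simps = linear_diff[OF linear_K] linear_add[OF linear_K] linear_scale[OF linear_K]

lemma g_eq: "u \<in> finite_on g \<Longrightarrow> g u = ereal (G u)"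
  by (rule proper_real_of_ereal[OF g(1)])

lemma f_eq: "v \<in> finite_on f \<Longrightarrow> f v = ereal (F v)"
  by (rule proper_real_of_ereal[OF f_proper])

lemma finite_on_ex:
  obtains a b where "a \<in> finite_on g" "b \<in> finite_on f"
  using g(1) f_proper unfolding proper_fun_def finite_on_def by blast

lemma s_bounds: "0 \<le> s" "s < 1"
proof -
  show "0 \<le> s" using steps onorm_pos_le[OF K] by (simp add: s_def)
  have "s\<^sup>2 < 1\<^sup>2" using steps by (simp add: s_def power_mult_distrib)
  then show "s < 1" by (rule power2_less_imp_less) simp
qed

lemma energy_nonneg: "0 \<le> energy u v"
  using steps by (simp add: energy_def)

lemma inner_K_le_energy: "\<bar>K u \<bullet> v\<bar> \<le> s * energy u v"
proof -
  \<comment> \<open>In these rescaled norms the bound on the coupling by \<open>K\<close> has the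
    constant \<open>s\<close>; Young's inequality then yields the energy.\<close>
  define p q where "p = norm u / sqrt \<tau>" and "q = norm v / sqrt \<sigma>"
  have "\<bar>K u \<bullet> v\<bar> \<le> norm (K u) * norm v" by (rule Cauchy_Schwarz_ineq2)
  also have "\<dots> \<le> onorm K * norm u * norm v"
    by (intro mult_right_mono onorm[OF K]) simp
  also have "\<dots> = s * (p * q)"
    using steps by (simp add: s_def p_def q_def real_sqrt_mult)
  also have "\<dots> \<le> s * ((p\<^sup>2 + q\<^sup>2) / 2)"
    using sum_squares_bound[of p q] s_bounds(1) by (intro mult_left_mono) auto
  also have "(p\<^sup>2 + q\<^sup>2) / 2 = energy u v"
    using steps by (simp add: p_def q_def energy_def power_divide field_simps)
  finally show ?thesis .
qed

text \<open>In the estimate of the mixed term, the part with \<open>dx n\<close> is exactly the last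
  summand of \<open>V\<close>, and the dual part costs the fraction \<open>s\<close> of the dual
  energy.\<close>

lemma V_ge: "(1 - s) * energy (a - x n) (b - y n) \<le> V a b n"
proof -
  have "K (dx n) \<bullet> (b - y n) \<le> s * energy (dx n) (b - y n)"
    using inner_K_le_energy[of "dx n" "b - y n"] by linarith
  moreover have "0 \<le> s * ((norm (a - x n))\<^sup>2 / (2 * \<tau>))"
    using s_bounds(1) steps by simp
  ultimately show ?thesis
    unfolding V_def energy_def left_diff_distrib distrib_left mult_1 by linarith
qed

lemma V_nonneg: "0 \<le> V a b n"
  using V_ge[of a n b] s_bounds energy_nonneg[of "a - x n" "b - y n"]
  by (meson diff_ge_0_iff_ge less_imp_le mult_nonneg_nonneg order_trans)

text \<open>Tested at a point of the domain, the subgradient inequality forces the new iterate into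
  the domain; after that it is an inequality between reals.\<close>

lemma primal_step:
  shows "x (Suc n) \<in> finite_on g"
    and "a \<in> finite_on g \<Longrightarrow>
      G (x (Suc n)) + (x n - x (Suc n)) \<bullet> (a - x (Suc n)) / \<tau>
        - y (Suc n) \<bullet> K (a - x (Suc n)) - \<epsilon> (Suc n) \<le> G a"
proof -
  define p where "p = (x n - \<tau> *\<^sub>R adjoint K (y (Suc n)) - x (Suc n)) /\<^sub>R \<tau>"
  have p: "g u \<ge> g (x (Suc n)) + ereal (p \<bullet> (u - x (Suc n))) - ereal (\<epsilon> (Suc n))" for u
    using iterates
    unfolding inexact_primal_dual_def prox_approx2_def eps_subdifferential_def p_def by auto
  obtain a0 where "a0 \<in> finite_on g" using finite_on_ex by blast
  then show fin: "x (Suc n) \<in> finite_on g"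
    using p[of a0] by (auto simp: finite_on_def)
  assume a: "a \<in> finite_on g"
  have "ereal (G (x (Suc n))) + ereal (p \<bullet> (a - x (Suc n))) - ereal (\<epsilon> (Suc n)) \<le> ereal (G a)"
    using p[of a] by (simp only: g_eq[OF fin, symmetric] g_eq[OF a, symmetric])
  then have "G (x (Suc n)) + p \<bullet> (a - x (Suc n)) - \<epsilon> (Suc n) \<le> G a"
    by (simp only: plus_ereal.simps ereal_minus(1) ereal_less_eq(3))
  moreover have "p \<bullet> w = (x n - x (Suc n)) \<bullet> w / \<tau> - y (Suc n) \<bullet> K w" for w
    using steps by (simp add: p_def inner_simps adjoint_inner[OF K] field_simps)
  ultimately show "G (x (Suc n)) + (x n - x (Suc n)) \<bullet> (a - x (Suc n)) / \<tau>
      - y (Suc n) \<bullet> K (a - x (Suc n)) - \<epsilon> (Suc n) \<le> G a"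
    by simp
qed

lemma dual_step:
  shows "y (Suc n) \<in> finite_on f"
    and "b \<in> finite_on f \<Longrightarrow>
      F (y (Suc n)) + (y n - y (Suc n)) \<bullet> (b - y (Suc n)) / \<sigma>
        + K (2 *\<^sub>R x n - x (n - 1)) \<bullet> (b - y (Suc n)) - \<delta> (Suc n) \<le> F b"
proof -
  define p where "p = (y n + \<sigma> *\<^sub>R K (2 *\<^sub>R x n - x (n - 1)) - y (Suc n)) /\<^sub>R \<sigma>"
  have p: "f u \<ge> f (y (Suc n)) + ereal (p \<bullet> (u - y (Suc n))) - ereal (\<delta> (Suc n))" for u
    using iterates
    unfolding inexact_primal_dual_def prox_approx2_def eps_subdifferential_def p_def by auto
  obtain b0 where "b0 \<in> finite_on f" using finite_on_ex by blast
  then show fin: "y (Suc n) \<in> finite_on f"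
    using p[of b0] by (auto simp: finite_on_def)
  assume b: "b \<in> finite_on f"
  have "ereal (F (y (Suc n))) + ereal (p \<bullet> (b - y (Suc n))) - ereal (\<delta> (Suc n)) \<le> ereal (F b)"
    using p[of b] by (simp only: f_eq[OF fin, symmetric] f_eq[OF b, symmetric])
  then have "F (y (Suc n)) + p \<bullet> (b - y (Suc n)) - \<delta> (Suc n) \<le> F b"
    by (simp only: plus_ereal.simps ereal_minus(1) ereal_less_eq(3))
  moreover have "p \<bullet> w = (y n - y (Suc n)) \<bullet> w / \<sigma> + K (2 *\<^sub>R x n - x (n - 1)) \<bullet> w" for w
    using steps by (simp add: p_def inner_simps field_simps)
  ultimately show "F (y (Suc n)) + (y n - y (Suc n)) \<bullet> (b - y (Suc n)) / \<sigma>
      + K (2 *\<^sub>R x n - x (n - 1)) \<bullet> (b - y (Suc n)) - \<delta> (Suc n) \<le> F b"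
    by simp
qed

lemma gap_step:
  assumes "a \<in> finite_on g" "b \<in> finite_on f"
  shows "gap (x (Suc n)) (y (Suc n)) a b
    \<le> V a b n - V a b (Suc n) - (1 - s) * energy (dx (Suc n)) (dy (Suc n)) + err (Suc n)"
proof -
  \<comment> \<open>The extrapolated point is \<open>x n + dx n\<close>, so the bilinear terms
    collapse to a telescoping difference and one mixed term.\<close>
  have "y (Suc n) \<bullet> K (a - x (Suc n)) - K (2 *\<^sub>R x n - x (n - 1)) \<bullet> (b - y (Suc n))
        + b \<bullet> K (x (Suc n)) - y (Suc n) \<bullet> K a
      = K (dx (Suc n)) \<bullet> (b - y (Suc n)) - K (dx n) \<bullet> (b - y n) + K (dx n) \<bullet> dy (Suc n)"
    unfolding dx_def dy_def by (simp add: K_simps inner_simps inner_commute)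
  \<comment> \<open>The first part is the last summand of \<open>V a b n\<close>; the second leaves
    the factor \<open>1 - s\<close> on the dual step.\<close>
  moreover have "K (dx n) \<bullet> dy (Suc n)
      \<le> s * ((norm (dx n))\<^sup>2 / (2 * \<tau>)) + s * ((norm (dy (Suc n)))\<^sup>2 / (2 * \<sigma>))"
    using inner_K_le_energy[of "dx n" "dy (Suc n)"] by (simp add: energy_def distrib_left)
  moreover have "(x n - x (Suc n)) \<bullet> (a - x (Suc n)) / \<tau>
      = (norm (a - x (Suc n)))\<^sup>2 / (2 * \<tau>) + (norm (dx (Suc n)))\<^sup>2 / (2 * \<tau>) - (norm (a - x n))\<^sup>2 / (2 * \<tau>)"
    unfolding inner_diff_three_points dx_def norm_minus_commute[of "x n"]
    by (simp add: add_divide_distrib diff_divide_distrib)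
  moreover have "(y n - y (Suc n)) \<bullet> (b - y (Suc n)) / \<sigma>
      = (norm (b - y (Suc n)))\<^sup>2 / (2 * \<sigma>) + (norm (dy (Suc n)))\<^sup>2 / (2 * \<sigma>) - (norm (b - y n))\<^sup>2 / (2 * \<sigma>)"
    unfolding inner_diff_three_points dy_def norm_minus_commute[of "y n"]
    by (simp add: add_divide_distrib diff_divide_distrib)
  ultimately show ?thesis
    using primal_step(2)[OF assms(1), of n] dual_step(2)[OF assms(2), of n]
    unfolding gap_def V_def err_def energy_def left_diff_distrib distrib_left mult_1
    by linarith
qed

lemma gap_sum:
  assumes "a \<in> finite_on g" "b \<in> finite_on f"
  shows "(\<Sum>n<N. gap (x (Suc n)) (y (Suc n)) a b) + (1 - s) * (\<Sum>n<N. energy (dx (Suc n)) (dy (Suc n)))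
    \<le> V a b 0 - V a b N + (\<Sum>n<N. err (Suc n))"
proof (induction N)
  case (Suc N)
  then show ?case using gap_step[OF assms, of N] by (simp add: distrib_left)
qed simp

lemma err_nonneg: "0 \<le> err (Suc n)"
  using errors[of "Suc n"] by (simp add: err_def)

lemma err_summable: "summable (\<lambda>n. err (Suc n))"
  using summable_add[OF summable] by (simp add: err_def)

lemma err_sum_le: "(\<Sum>n<N. err (Suc n)) \<le> (\<Sum>n. err (Suc n))"
  using err_nonneg by (intro sum_le_suminf err_summable) auto

section \<open>Saddle points as limits of points with vanishing gap\<close>

text \<open>Both saddle inequalities together amount to \<open>L(xs, b) \<le> L(a, ys)\<close> for
  all \<open>a\<close> and \<open>b\<close>. For \<open>xs\<close> and \<open>ys\<close> in the
  domains this is trivial off the domains, where the left side is \<open>-\<infinity>\<close> or the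
  right side is \<open>\<infinity>\<close>.\<close>

lemma saddle_point_iff_gap:
  "saddle_point (Lagrangian K g h) (xs, ys) \<longleftrightarrow>
    xs \<in> finite_on g \<and> ys \<in> finite_on f \<and> (\<forall>a\<in>finite_on g. \<forall>b\<in>finite_on f. gap xs ys a b \<le> 0)"
proof -
  have L: "Lagrangian K g h u v = ereal (v \<bullet> K u + G u - F v)"
    if "u \<in> finite_on g" "v \<in> finite_on f" for u v
  proof -
    have "ereal (v \<bullet> K u) + ereal (G u) - ereal (F v) = ereal (v \<bullet> K u + G u - F v)"
      by (simp only: plus_ereal.simps ereal_minus(1))
    then show ?thesis
      by (simp only: Lagrangian_def g_eq[OF that(1), symmetric] f_eq[OF that(2), symmetric])
  qed
  have gap_L: "gap u v a b \<le> 0 \<longleftrightarrow> Lagrangian K g h u b \<le> Lagrangian K g h a v"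
    if "u \<in> finite_on g" "v \<in> finite_on f" "a \<in> finite_on g" "b \<in> finite_on f" for u v a b
    using that by (simp add: L gap_def)
  have L1: "Lagrangian K g h u v = -\<infinity>" if "u \<in> finite_on g" "v \<notin> finite_on f" for u v
    using that(2) by (subst Lagrangian_def, subst g_eq[OF that(1)]) (simp add: finite_on_def)
  have L2: "Lagrangian K g h u v = \<infinity>" if "u \<notin> finite_on g" for u v
    using that by (simp add: Lagrangian_def finite_on_def)
  obtain a0 b0 where a0: "a0 \<in> finite_on g" and b0: "b0 \<in> finite_on f" by (rule finite_on_ex)
  show ?thesis
  proof
    assume sp: "saddle_point (Lagrangian K g h) (xs, ys)"
    have le: "Lagrangian K g h xs b \<le> Lagrangian K g h a ys" for a b
      using sp unfolding saddle_point_def by (metis fst_conv snd_conv order_trans)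
    have ys: "ys \<in> finite_on f"
    proof (rule ccontr)
      assume "ys \<notin> finite_on f"
      then have "Lagrangian K g h xs b0 = -\<infinity>" using le[of b0 a0] L1[OF a0] by simp
      then show False using L[of xs b0] L2[of xs b0] b0 by (cases "xs \<in> finite_on g") auto
    qed
    have xs: "xs \<in> finite_on g"
    proof (rule ccontr)
      assume "xs \<notin> finite_on g"
      then show False using le[of b0 a0] L2[of xs b0] L[OF a0 ys] by simp
    qed
    show "xs \<in> finite_on g \<and> ys \<in> finite_on f \<and> (\<forall>a\<in>finite_on g. \<forall>b\<in>finite_on f. gap xs ys a b \<le> 0)"
      using xs ys le by (simp add: gap_L)
  next
    assume *: "xs \<in> finite_on g \<and> ys \<in> finite_on f \<and> (\<forall>a\<in>finite_on g. \<forall>b\<in>finite_on f. gap xs ys a b \<le> 0)"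
    then have le: "Lagrangian K g h xs b \<le> Lagrangian K g h a ys" for a b
      by (cases "a \<in> finite_on g"; cases "b \<in> finite_on f") (auto simp: gap_L[symmetric] L1 L2)
    then show "saddle_point (Lagrangian K g h) (xs, ys)"
      unfolding saddle_point_def by simp
  qed
qed

lemma gap_swap: "gap u v a b = - gap a b u v"
  by (simp add: gap_def)

text \<open>The values \<open>g xs\<close> and \<open>f ys\<close> are not yet known to be finite, so real numbers below them
  take their place in the gap.\<close>

lemma weak_cluster_point_bound:
  assumes cluster: "weak_cluster_point (\<lambda>k. (u k, v k)) (xs, ys)"
    and fin: "\<forall>\<^sub>F k in sequentially. u k \<in> finite_on g \<and> v k \<in> finite_on f"
    and gap: "\<forall>\<^sub>F k in sequentially. gap (u k) (v k) a b \<le> c k" "c \<longlonglongrightarrow> 0"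
    and \<alpha>: "ereal \<alpha> < g xs" and \<beta>: "ereal \<beta> < f ys"
  shows "\<alpha> + \<beta> + b \<bullet> K xs - ys \<bullet> K a \<le> G a + F b"
proof (rule field_le_epsilon)
  fix e :: real assume "e > 0"
  obtain d1 \<alpha>' where d1: "\<alpha>' < xs \<bullet> d1"
    "\<And>u. u \<in> finite_on g \<Longrightarrow> \<alpha>' < u \<bullet> d1 \<Longrightarrow> \<alpha> < G u"
    using convex_fun_weak_lsc_real[OF g(1,2) lsc_fun_closed_sublevel[OF g(3)] \<alpha>] by blast
  obtain d2 \<beta>' where d2: "\<beta>' < ys \<bullet> d2"
    "\<And>v. v \<in> finite_on f \<Longrightarrow> \<beta>' < v \<bullet> d2 \<Longrightarrow> \<beta> < F v"
    using convex_fun_weak_lsc_real[OF f_proper f_convex closed_convex_conjugate_sublevel[OF h(1)] \<beta>]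
    by blast
  \<comment> \<open>For fixed \<open>(a, b)\<close> this is the part of the gap that is linear in
    \<open>(u, v)\<close>, hence weakly continuous.\<close>
  define l where "l z = b \<bullet> K (fst z) - snd z \<bullet> K a" for z
  have l: "bounded_linear l"
    unfolding l_def
    by (intro bounded_linear_sub bounded_linear_compose[OF bounded_linear_inner_right]
        bounded_linear_compose[OF bounded_linear_inner_left] bounded_linear_compose[OF K]
        bounded_linear_fst bounded_linear_snd)
  \<comment> \<open>Half of \<open>e\<close> is spent on the variation of \<open>l\<close>, the
    other half on \<open>c k\<close>.\<close>
  define W where "W = (\<lambda>z. fst z \<bullet> d1) -` {\<alpha>'<..} \<inter> (\<lambda>z. snd z \<bullet> d2) -` {\<beta>'<..}
    \<inter> l -` {l (xs, ys) - e / 2<..}"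
  have "openin weak_topology W"
    unfolding W_def
    by (intro openin_Int openin_weak_topology_vimage l open_greaterThan
        bounded_linear_compose[OF bounded_linear_inner_left] bounded_linear_fst bounded_linear_snd)
  moreover have "(xs, ys) \<in> W" using d1 d2 \<open>e > 0\<close> by (simp add: W_def)
  ultimately have "\<exists>\<^sub>F k in sequentially. (u k, v k) \<in> W"
    using cluster unfolding weak_cluster_point_def by blast
  moreover have "\<forall>\<^sub>F k in sequentially. (u k \<in> finite_on g \<and> v k \<in> finite_on f)
      \<and> gap (u k) (v k) a b \<le> c k \<and> c k < e / 2"
    by (rule eventually_conj[OF fin eventually_conj[OF gap(1)
            order_tendstoD(2)[OF gap(2) half_gt_zero[OF \<open>e > 0\<close>]]]])
  ultimately have "\<exists>\<^sub>F k in sequentially. (u k, v k) \<in> W \<and> (u k \<in> finite_on g \<and> v k \<in> finite_on f)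
      \<and> gap (u k) (v k) a b \<le> c k \<and> c k < e / 2"
    by (rule frequently_eventually_frequently)
  then obtain k where "(u k, v k) \<in> W" "u k \<in> finite_on g" "v k \<in> finite_on f"
    "gap (u k) (v k) a b < e / 2"
    using frequently_ex by fastforce
  then have "\<alpha> < G (u k)" "\<beta> < F (v k)" "l (xs, ys) - e / 2 < l (u k, v k)"
    and "gap (u k) (v k) a b < e / 2"
    using d1(2)[of "u k"] d2(2)[of "v k"] by (auto simp: W_def)
  then show "\<alpha> + \<beta> + b \<bullet> K xs - ys \<bullet> K a \<le> G a + F b + e"
    unfolding gap_def l_def fst_conv snd_conv by linarith
qed

lemma weak_cluster_point_saddle:
  assumes cluster: "weak_cluster_point (\<lambda>k. (u k, v k)) (xs, ys)"
    and fin: "\<forall>\<^sub>F k in sequentially. u k \<in> finite_on g \<and> v k \<in> finite_on f"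
    and gap: "\<And>a b. a \<in> finite_on g \<Longrightarrow> b \<in> finite_on f \<Longrightarrow>
      \<exists>c. (\<forall>\<^sub>F k in sequentially. gap (u k) (v k) a b \<le> c k) \<and> c \<longlonglongrightarrow> 0"
  shows "saddle_point (Lagrangian K g h) (xs, ys)"
proof -
  have bound: "\<alpha> + \<beta> + b \<bullet> K xs - ys \<bullet> K a \<le> G a + F b"
    if "ereal \<alpha> < g xs" "ereal \<beta> < f ys" "a \<in> finite_on g" "b \<in> finite_on f" for \<alpha> \<beta> a b
    using gap[OF that(3,4)] weak_cluster_point_bound[OF cluster fin _ _ that(1,2)] by blast
  obtain a0 b0 where ab0: "a0 \<in> finite_on g" "b0 \<in> finite_on f" by (rule finite_on_ex)
  obtain \<alpha>0 where \<alpha>0: "ereal \<alpha>0 < g xs"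
    using g(1) ereal_dense2[of "-\<infinity>" "g xs"] unfolding proper_fun_def ereal_infty_less by blast
  obtain \<beta>0 where \<beta>0: "ereal \<beta>0 < f ys"
    using f_proper ereal_dense2[of "-\<infinity>" "f ys"] unfolding proper_fun_def ereal_infty_less by blast
  \<comment> \<open>If \<open>g xs\<close> were infinite, any real would be admissible as
    \<open>\<alpha>\<close>; the one chosen turns the bound into
    \<open>G a0 + F b0 + 1 \<le> G a0 + F b0\<close>.\<close>
  have xs: "xs \<in> finite_on g"
  proof (rule ccontr)
    assume "xs \<notin> finite_on g"
    then have "g xs = \<infinity>" by (simp add: finite_on_def)
    then show False
      using bound[of "G a0 + F b0 - \<beta>0 - b0 \<bullet> K xs + ys \<bullet> K a0 + 1" \<beta>0 a0 b0] \<beta>0 ab0 by simp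
  qed
  have ys: "ys \<in> finite_on f"
  proof (rule ccontr)
    assume "ys \<notin> finite_on f"
    then have "f ys = \<infinity>" by (simp add: finite_on_def)
    then show False
      using bound[of \<alpha>0 "G a0 + F b0 - \<alpha>0 - b0 \<bullet> K xs + ys \<bullet> K a0 + 1" a0 b0] \<alpha>0 ab0 by simp
  qed
  have "gap xs ys a b \<le> 0" if ab: "a \<in> finite_on g" "b \<in> finite_on f" for a b
  proof (rule field_le_epsilon)
    fix e :: real assume "e > 0"
    have "ereal (G xs - e / 2) < g xs" "ereal (F ys - e / 2) < f ys"
      using g_eq[OF xs] f_eq[OF ys] \<open>e > 0\<close> by (metis diff_less_eq half_gt_zero less_add_same_cancel1 less_ereal.simps(1))+
    from bound[OF this ab] show "gap xs ys a b \<le> 0 + e"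
      unfolding gap_def by (simp add: field_simps)
  qed
  then show ?thesis using xs ys by (simp add: saddle_point_iff_gap)
qed

section \<open>Convergence\<close>

text \<open>The gap is convex in its first two arguments, so at the means it is at most the average
  of the gaps, whose sum is bounded uniformly in \<open>N\<close>.\<close>

lemma ergodic_gap:
  assumes N: "N \<ge> 1" and ab: "a \<in> finite_on g" "b \<in> finite_on f"
  shows "ergodic_mean x N \<in> finite_on g" "ergodic_mean y N \<in> finite_on f"
    and "gap (ergodic_mean x N) (ergodic_mean y N) a b \<le> (V a b 0 + (\<Sum>n. err (Suc n))) / real N"
proof -
  have finx: "x n \<in> finite_on g" if "n \<ge> 1" for n
    using primal_step(1)[of "n - 1"] that by simp
  have finy: "y n \<in> finite_on f" if "n \<ge> 1" for n
    using dual_step(1)[of "n - 1"] that by simp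
  have gx: "g (ergodic_mean x N) \<le> ereal ((\<Sum>n=1..N. G (x n)) / real N)"
    by (rule convex_fun_ergodic_mean[OF g(1,2) N finx])
  have fy: "f (ergodic_mean y N) \<le> ereal ((\<Sum>n=1..N. F (y n)) / real N)"
    by (rule convex_fun_ergodic_mean[OF f_proper f_convex N finy])
  show x: "ergodic_mean x N \<in> finite_on g" using gx by (auto simp: finite_on_def)
  show y: "ergodic_mean y N \<in> finite_on f" using fy by (auto simp: finite_on_def)
  have "G (ergodic_mean x N) \<le> (\<Sum>n=1..N. G (x n)) / real N"
    using gx g_eq[OF x] by (metis ereal_less_eq(3))
  moreover have "F (ergodic_mean y N) \<le> (\<Sum>n=1..N. F (y n)) / real N"
    using fy f_eq[OF y] by (metis ereal_less_eq(3))
  moreover have "b \<bullet> K (ergodic_mean x N) = (\<Sum>n=1..N. b \<bullet> K (x n)) / real N"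
    unfolding ergodic_mean_def by (simp add: K_simps linear_sum[OF linear_K] inner_sum_right)
  moreover have "ergodic_mean y N \<bullet> K a = (\<Sum>n=1..N. y n \<bullet> K a) / real N"
    unfolding ergodic_mean_def by (simp add: inner_sum_left)
  moreover have "(\<Sum>n=1..N. gap (x n) (y n) a b) / real N
      = (\<Sum>n=1..N. b \<bullet> K (x n)) / real N + (\<Sum>n=1..N. G (x n)) / real N - F b
        - ((\<Sum>n=1..N. y n \<bullet> K a) / real N + G a - (\<Sum>n=1..N. F (y n)) / real N)"
    using N unfolding gap_def by (simp add: sum.distrib sum_subtractf field_simps)
  ultimately have "gap (ergodic_mean x N) (ergodic_mean y N) a b \<le> (\<Sum>n=1..N. gap (x n) (y n) a b) / real N"
    unfolding gap_def[of "ergodic_mean x N"] by linarith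
  also have "(\<Sum>n=1..N. gap (x n) (y n) a b) = (\<Sum>n<N. gap (x (Suc n)) (y (Suc n)) a b)"
    by (simp add: sum.shift_bounds_cl_Suc_ivl[symmetric] sum.atLeast1_atMost_eq)
  also have "\<dots> \<le> V a b 0 + (\<Sum>n. err (Suc n))"
  proof -
    have "0 \<le> (1 - s) * (\<Sum>n<N. energy (dx (Suc n)) (dy (Suc n)))"
      using s_bounds energy_nonneg by (intro mult_nonneg_nonneg sum_nonneg) auto
    then show ?thesis
      using gap_sum[OF ab, of N] err_sum_le[of N] V_nonneg[of a b N] by linarith
  qed
  finally show "gap (ergodic_mean x N) (ergodic_mean y N) a b
      \<le> (V a b 0 + (\<Sum>n. err (Suc n))) / real N"
    by (simp add: divide_right_mono)
qed

lemma ergodic_saddle: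
  assumes "weak_cluster_point (\<lambda>N. (ergodic_mean x N, ergodic_mean y N)) p"
  shows "saddle_point (Lagrangian K g h) p"
proof (cases p)
  case (Pair xs ys)
  obtain a0 b0 where ab0: "a0 \<in> finite_on g" "b0 \<in> finite_on f" by (rule finite_on_ex)
  show ?thesis
    unfolding Pair
  proof (rule weak_cluster_point_saddle)
    show "weak_cluster_point (\<lambda>N. (ergodic_mean x N, ergodic_mean y N)) (xs, ys)"
      using assms Pair by simp
    \<comment> \<open>The mean for \<open>N = 0\<close> is 0, which may lie outside the
      domains.\<close>
    show "\<forall>\<^sub>F N in sequentially. ergodic_mean x N \<in> finite_on g \<and> ergodic_mean y N \<in> finite_on f"
      using ergodic_gap(1,2)[OF _ ab0] by (intro eventually_sequentiallyI[of 1]) blast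
    fix a b assume ab: "a \<in> finite_on g" "b \<in> finite_on f"
    have "\<forall>\<^sub>F N in sequentially. gap (ergodic_mean x N) (ergodic_mean y N) a b
        \<le> (V a b 0 + (\<Sum>n. err (Suc n))) / real N"
      using ergodic_gap(3)[OF _ ab] by (intro eventually_sequentiallyI[of 1]) blast
    then show "\<exists>c. (\<forall>\<^sub>F N in sequentially. gap (ergodic_mean x N) (ergodic_mean y N) a b \<le> c N) \<and> c \<longlonglongrightarrow> 0"
      by (intro exI[of _ "\<lambda>N. (V a b 0 + (\<Sum>n. err (Suc n))) / real N"] conjI lim_const_over_n)
  qed
qed

section \<open>Convergence of the iterates in finite dimensions\<close>

lemma saddle_descent:
  assumes "saddle_point (Lagrangian K g h) (a, b)"
  shows "(1 - s) * (\<Sum>n<N. energy (dx (Suc n)) (dy (Suc n))) + V a b N \<le> V a b 0 + (\<Sum>n. err (Suc n))"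
    and "V a b (Suc N) \<le> V a b N + err (Suc N)"
proof -
  have ab: "a \<in> finite_on g" "b \<in> finite_on f"
    and "\<And>u v. u \<in> finite_on g \<Longrightarrow> v \<in> finite_on f \<Longrightarrow> gap a b u v \<le> 0"
    using assms unfolding saddle_point_iff_gap by auto
  \<comment> \<open>The saddle point has nonpositive gap against the iterate; exchanging the two
    pairs flips the sign.\<close>
  then have gap0: "0 \<le> gap (x (Suc n)) (y (Suc n)) a b" for n
    using primal_step(1)[of n] dual_step(1)[of n] by (subst gap_swap) simp
  then have "0 \<le> (\<Sum>n<N. gap (x (Suc n)) (y (Suc n)) a b)" by (simp add: sum_nonneg)
  then show "(1 - s) * (\<Sum>n<N. energy (dx (Suc n)) (dy (Suc n))) + V a b N \<le> V a b 0 + (\<Sum>n. err (Suc n))"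
    using gap_sum[OF ab, of N] err_sum_le[of N] by linarith
  have "0 \<le> (1 - s) * energy (dx (Suc N)) (dy (Suc N))"
    using s_bounds energy_nonneg by (intro mult_nonneg_nonneg) auto
  then show "V a b (Suc N) \<le> V a b N + err (Suc N)"
    using gap_step[OF ab, of N] gap0[of N] by linarith
qed

lemma energy_ge: "(norm u)\<^sup>2 \<le> 2 * \<tau> * energy u v" "(norm v)\<^sup>2 \<le> 2 * \<sigma> * energy u v"
  using steps by (auto simp: energy_def field_simps)

lemma energy_tendsto_0:
  assumes "(\<lambda>n. energy (u n) (v n)) \<longlonglongrightarrow> 0"
  shows "u \<longlonglongrightarrow> 0" "v \<longlonglongrightarrow> 0"
proof -
  have aux: "w \<longlonglongrightarrow> 0" if "\<And>n. (norm (w n))\<^sup>2 \<le> c * energy (u n) (v n)"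
    for w :: "nat \<Rightarrow> 'c::real_normed_vector" and c
  proof -
    have "(\<lambda>n. c * energy (u n) (v n)) \<longlonglongrightarrow> 0"
      using tendsto_mult_right_zero[OF assms] .
    then have "(\<lambda>n. (norm (w n))\<^sup>2) \<longlonglongrightarrow> 0"
      by (rule tendsto_sandwich[OF _ _ tendsto_const, rotated -1]) (use that in auto)
    then show ?thesis
      using tendsto_real_sqrt[of "\<lambda>n. (norm (w n))\<^sup>2" 0] by (simp add: tendsto_norm_zero_iff)
  qed
  show "u \<longlonglongrightarrow> 0" using aux[of u] energy_ge(1) by blast
  show "v \<longlonglongrightarrow> 0" using aux[of v] energy_ge(2) by blast
qed

text \<open>Since \<open>1 - s\<close> is positive and \<open>V\<close> nonnegative, the descent
  estimate makes the step energies summable.\<close>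

lemma increments_tendsto_0:
  assumes "saddle_point (Lagrangian K g h) p"
  shows "dx \<longlonglongrightarrow> 0" "dy \<longlonglongrightarrow> 0"
proof -
  obtain a b where p: "p = (a, b)" by (cases p)
  define c where "c = (V a b 0 + (\<Sum>n. err (Suc n))) / (1 - s)"
  have "(\<Sum>n<N. energy (dx (Suc n)) (dy (Suc n))) \<le> c" for N
    using saddle_descent(1)[OF assms[unfolded p], of N] V_nonneg[of a b N] s_bounds
    by (simp add: c_def field_simps)
  then have "summable (\<lambda>n. energy (dx (Suc n)) (dy (Suc n)))"
    using energy_nonneg
    by (intro bounded_imp_summable[where B = c]) (simp_all only: lessThan_Suc_atMost[symmetric])
  then have lim: "(\<lambda>n. energy (dx (Suc n)) (dy (Suc n))) \<longlonglongrightarrow> 0"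
    by (rule summable_LIMSEQ_zero)
  show "dx \<longlonglongrightarrow> 0" by (rule LIMSEQ_imp_Suc[OF energy_tendsto_0(1)[OF lim]])
  show "dy \<longlonglongrightarrow> 0" by (rule LIMSEQ_imp_Suc[OF energy_tendsto_0(2)[OF lim]])
qed

lemma Bseq_of_power2_norm_diff_le:
  fixes w :: "nat \<Rightarrow> 'c::real_normed_vector"
  assumes "\<And>n. (norm (a - w n))\<^sup>2 \<le> c"
  shows "Bseq w"
proof (rule BseqI')
  fix n
  have "norm (a - w n) \<le> sqrt c" using assms[of n] by (rule real_le_rsqrt)
  then show "norm (w n) \<le> norm a + sqrt c"
    using norm_triangle_ineq3[of a "w n"] norm_triangle_ineq2[of "w n" a]
    by (simp add: norm_minus_commute)
qed

lemma iterates_bounded: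
  assumes "saddle_point (Lagrangian K g h) p"
  shows "Bseq x" "Bseq y"
proof -
  obtain a b where p: "p = (a, b)" by (cases p)
  define c where "c = (V a b 0 + (\<Sum>n. err (Suc n))) / (1 - s)"
  have "energy (a - x n) (b - y n) \<le> c" for n
  proof -
    have "0 \<le> (1 - s) * (\<Sum>k<n. energy (dx (Suc k)) (dy (Suc k)))"
      using s_bounds energy_nonneg by (intro mult_nonneg_nonneg sum_nonneg) auto
    then have "(1 - s) * energy (a - x n) (b - y n) \<le> V a b 0 + (\<Sum>n. err (Suc n))"
      using saddle_descent(1)[OF assms[unfolded p], of n] V_ge[of a n b] by linarith
    then show ?thesis using s_bounds by (simp add: c_def field_simps)
  qed
  then have le: "(norm (a - x n))\<^sup>2 \<le> 2 * \<tau> * c" "(norm (b - y n))\<^sup>2 \<le> 2 * \<sigma> * c" for n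
    using energy_ge(1)[of "a - x n" "b - y n"] energy_ge(2)[of "b - y n" "a - x n"] steps
    by (meson mult_left_mono less_imp_le mult_pos_pos order_trans zero_less_numeral)+
  show "Bseq x" by (rule Bseq_of_power2_norm_diff_le[OF le(1)])
  show "Bseq y" by (rule Bseq_of_power2_norm_diff_le[OF le(2)])
qed

lemma V_tendsto:
  assumes "(\<lambda>k. x (r k)) \<longlonglongrightarrow> xs" "(\<lambda>k. y (r k)) \<longlonglongrightarrow> ys" "(\<lambda>k. dx (r k)) \<longlonglongrightarrow> 0"
  shows "(\<lambda>k. V a b (r k)) \<longlonglongrightarrow> energy (a - xs) (b - ys)"
proof -
  have "(\<lambda>k. V a b (r k)) \<longlonglongrightarrow> energy (a - xs) (b - ys) - K 0 \<bullet> (b - ys) + s * ((norm (0::'a))\<^sup>2 / (2 * \<tau>))"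
    unfolding V_def energy_def using steps
    by (intro tendsto_intros assms bounded_linear.tendsto[OF K]) auto
  then show ?thesis using linear_0[OF linear_K] by simp
qed

lemma finite_dim_convergence:
  assumes sp: "saddle_point (Lagrangian K g h) p"
    and dim: "finite_dim TYPE('a)" "finite_dim TYPE('b)"
  shows "\<exists>xs ys. saddle_point (Lagrangian K g h) (xs, ys) \<and> x \<longlonglongrightarrow> xs \<and> y \<longlonglongrightarrow> ys"
proof -
  obtain r1 xs where r1: "strict_mono (r1 :: nat \<Rightarrow> nat)" "(\<lambda>n. x (r1 n)) \<longlonglongrightarrow> xs"
    using finite_dim_convergent_subsequence[OF dim(1) iterates_bounded(1)[OF sp]] by blast
  have "Bseq (\<lambda>n. y (r1 n))"
    using iterates_bounded(2)[OF sp] by (auto simp: Bseq_def)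
  then obtain r2 ys where r2: "strict_mono (r2 :: nat \<Rightarrow> nat)" "(\<lambda>n. y (r1 (r2 n))) \<longlonglongrightarrow> ys"
    using finite_dim_convergent_subsequence[OF dim(2)] by blast
  define r where "r = r1 \<circ> r2"
  have r: "strict_mono r" unfolding r_def by (rule strict_mono_o[OF r1(1) r2(1)])
  have x_r: "(\<lambda>k. x (r k)) \<longlonglongrightarrow> xs"
    using LIMSEQ_subseq_LIMSEQ[OF r1(2) r2(1)] by (simp add: r_def o_def)
  have y_r: "(\<lambda>k. y (r k)) \<longlonglongrightarrow> ys"
    using r2(2) by (simp add: r_def)
  have dx_r: "(\<lambda>k. dx (r k)) \<longlonglongrightarrow> 0"
    using LIMSEQ_subseq_LIMSEQ[OF increments_tendsto_0(1)[OF sp] r] by (simp add: o_def)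
  have dx_Sr: "(\<lambda>k. dx (Suc (r k))) \<longlonglongrightarrow> 0"
    using LIMSEQ_subseq_LIMSEQ[OF LIMSEQ_Suc[OF increments_tendsto_0(1)[OF sp]] r] by (simp add: o_def)
  have dy_Sr: "(\<lambda>k. dy (Suc (r k))) \<longlonglongrightarrow> 0"
    using LIMSEQ_subseq_LIMSEQ[OF LIMSEQ_Suc[OF increments_tendsto_0(2)[OF sp]] r] by (simp add: o_def)
  \<comment> \<open>The shifted indices have the same limit because the increments vanish. They are
    the ones at which \<open>gap_step\<close> bounds the gap, and they avoid the initial point,
    which may lie outside the domains.\<close>
  have x_Sr: "(\<lambda>k. x (Suc (r k))) \<longlonglongrightarrow> xs"
    using tendsto_add[OF x_r dx_Sr] by (simp add: dx_def)
  have y_Sr: "(\<lambda>k. y (Suc (r k))) \<longlonglongrightarrow> ys"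
    using tendsto_add[OF y_r dy_Sr] by (simp add: dy_def)
  have err_r: "(\<lambda>k. err (Suc (r k))) \<longlonglongrightarrow> 0"
    using LIMSEQ_subseq_LIMSEQ[OF summable_LIMSEQ_zero[OF err_summable] r] by (simp add: o_def)
  have saddle: "saddle_point (Lagrangian K g h) (xs, ys)"
  proof (rule weak_cluster_point_saddle)
    show "weak_cluster_point (\<lambda>k. (x (Suc (r k)), y (Suc (r k)))) (xs, ys)"
      by (intro tendsto_imp_weak_cluster_point tendsto_Pair x_Sr y_Sr)
    show "\<forall>\<^sub>F k in sequentially. x (Suc (r k)) \<in> finite_on g \<and> y (Suc (r k)) \<in> finite_on f"
      using primal_step(1) dual_step(1) by simp
    fix a b assume ab: "a \<in> finite_on g" "b \<in> finite_on f"
    \<comment> \<open>Both values of \<open>V\<close> tend to the same energy, so \<open>c\<close>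
      tends to 0.\<close>
    define c where "c k = V a b (r k) - V a b (Suc (r k)) + err (Suc (r k))" for k
    have "gap (x (Suc (r k))) (y (Suc (r k))) a b \<le> c k" for k
    proof -
      have "0 \<le> (1 - s) * energy (dx (Suc (r k))) (dy (Suc (r k)))"
        using s_bounds energy_nonneg by (intro mult_nonneg_nonneg) auto
      then show ?thesis using gap_step[OF ab, of "r k"] unfolding c_def by linarith
    qed
    moreover have "c \<longlonglongrightarrow> energy (a - xs) (b - ys) - energy (a - xs) (b - ys) + 0"
      unfolding c_def
      by (intro tendsto_add tendsto_diff V_tendsto[OF x_r y_r dx_r] err_r
          V_tendsto[of "\<lambda>k. Suc (r k)", OF x_Sr y_Sr dx_Sr])
    ultimately show "\<exists>c. (\<forall>\<^sub>F k in sequentially. gap (x (Suc (r k))) (y (Suc (r k))) a b \<le> c k) \<and> c \<longlonglongrightarrow> 0"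
      by (intro exI[of _ c]) simp
  qed
  \<comment> \<open>The subsequential limit is now known to be a saddle point, so it can serve as
    the reference pair of \<open>V\<close>.\<close>
  have "V xs ys \<longlonglongrightarrow> 0"
  proof (rule quasi_Fejer_tendsto_0[OF V_nonneg saddle_descent(2)[OF saddle] err_nonneg err_summable r])
    show "(\<lambda>k. V xs ys (r k)) \<longlonglongrightarrow> 0"
      using V_tendsto[OF x_r y_r dx_r, of xs ys] by (simp add: energy_def)
  qed
  then have "(\<lambda>n. V xs ys n / (1 - s)) \<longlonglongrightarrow> 0"
    using tendsto_divide_zero by blast
  then have "(\<lambda>n. energy (xs - x n) (ys - y n)) \<longlonglongrightarrow> 0"
    by (rule tendsto_sandwich[OF _ _ tendsto_const, rotated -1])
      (use energy_nonneg V_ge[of xs _ ys] s_bounds in \<open>auto simp: field_simps\<close>)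
  from energy_tendsto_0[OF this] have "x \<longlonglongrightarrow> xs" "y \<longlonglongrightarrow> ys"
    using tendsto_diff[OF tendsto_const[of xs], of "\<lambda>n. xs - x n" 0]
      tendsto_diff[OF tendsto_const[of ys], of "\<lambda>n. ys - y n" 0] by simp_all
  then show ?thesis using saddle by blast
qed

end

theorem theorem3p8:
  fixes K :: "'a::{real_inner, banach} \<Rightarrow> 'b::{real_inner, banach}"
    and g :: "'a \<Rightarrow> ereal" and h :: "'b \<Rightarrow> ereal"
    and \<tau> \<sigma> :: real and \<epsilon> \<delta> :: "nat \<Rightarrow> real"
    and x :: "nat \<Rightarrow> 'a" and y :: "nat \<Rightarrow> 'b"
  assumes K: "bounded_linear K"
    and g: "proper_fun g" "convex_fun g" "lsc_fun g"
    and h: "proper_fun h" "convex_fun h" "lsc_fun h"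
    and saddle: "\<exists>p. saddle_point (Lagrangian K g h) p"
    and steps: "\<tau> > 0" "\<sigma> > 0" "\<tau> * \<sigma> * (onorm K)\<^sup>2 < 1"
    and errors: "\<And>n. n \<ge> 1 \<Longrightarrow> \<epsilon> n \<ge> 0" "\<And>n. n \<ge> 1 \<Longrightarrow> \<delta> n \<ge> 0"
    and iterates: "inexact_primal_dual K g h \<tau> \<sigma> \<epsilon> \<delta> x y"
    and summable: "summable (\<lambda>n. \<epsilon> (n + 1))" "summable (\<lambda>n. \<delta> (n + 1))"
  shows "(\<forall>p. weak_cluster_point (\<lambda>N. (ergodic_mean x N, ergodic_mean y N)) p
             \<longrightarrow> saddle_point (Lagrangian K g h) p) \<and>
         (finite_dim TYPE('a) \<and> finite_dim TYPE('b) \<longrightarrow>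
           (\<exists>xs ys. saddle_point (Lagrangian K g h) (xs, ys) \<and>
              x \<longlonglongrightarrow> xs \<and> y \<longlonglongrightarrow> ys))"
proof -
  interpret primal_dual K g h \<tau> \<sigma> \<epsilon> \<delta> x y
    by (rule primal_dual.intro) (fact assms)+
  show ?thesis using ergodic_saddle finite_dim_convergence saddle by blast
qed

end
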